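(* Let $d\ge1$, let $(X_\ell)_{\ell\in\mathbb Z^d}$ be a real random field on a probability space $(\Omega,\mathcal F,\mathbb P)$ whose variables have a common distribution function $F$, and let $(z_k)_{k\ge0}$ be a sequence in $\mathbb Z^d$ with number of self-intersections $V_n$. a) If $(X_\ell)_{\ell\in\mathbb Z^d}$ are i.i.d. and $V_n=o\big(n^2(\log\log n)^{-1}\big)$, then $(X_\ell)$ satisfies a Glivenko-Cantelli theorem along $(z_k)$: $$\lim_n\ \sup_{s\in\mathbb R}\Big|\frac1n\sum_{k=1}^n \mathbf 1_{(-\infty,s]}(X_{z_k}(\omega))-F(s)\Big|=0\quad\text{for }\mathbb P\text{-a.e. }\omega.$$ b) If $(X_\ell)_{\ell\in\mathbb Z^d}$ is a strictly stationary random field of associated, square integrable random variables such that $\sum_{\ell\in\mathbb Z^d}\langle X_\ell,X_{0}\rangle$ converges, and if $V_n=O\big(n^2(\log n)^{-(1+\eta)}\big)$ for some $\eta>0$, then for a.e. $\omega$ we have, for each continuity point $s$ of $F$, $$\lim_n\frac1n\sum_{k=0}^{n-1}\mathbf 1_{(-\infty,s]}(X_{z_k}(\omega))=F(s).$$ If moreover $F$ is continuous, the convergence is uniform in $s$.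
   Context: For a sequence $(z_k)_{k\ge0}$ in $\mathbb Z^d$ and $n\ge1$, $V_n:=\#\{(j,k):0\le j,k\le n-1,\ z_j=z_k\}$. $\langle X,Y\rangle=\mathbb E[XY]$. A finite family $\mathbf T=(T_1,\dots,T_n)$ of real random variables is associated if $\mathrm{Cov}[f(\mathbf T),g(\mathbf T)]\ge0$ for all coordinate-wise non-decreasing $f,g:\mathbb R^n\to\mathbb R$ for which $\mathbb E[f(\mathbf T)]$, $\mathbb E[g(\mathbf T)]$, $\mathbb E[f(\mathbf T)g(\mathbf T)]$ exist; an infinite family is associated if every finite subfamily is. *)

theory Defs
  imports "HOL-Probability.Probability" "HOL-Library.Landau_Symbols"
begin

definition self_intersections :: "(nat \<Rightarrow> 'l) \<Rightarrow> nat \<Rightarrow> nat" where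
  "self_intersections z n = card {(j, k). j < n \<and> k < n \<and> z j = z k}"

definition covariance :: "'a measure \<Rightarrow> ('a \<Rightarrow> real) \<Rightarrow> ('a \<Rightarrow> real) \<Rightarrow> real" where
  "covariance M Y Z =
     (\<integral>\<omega>. (Y \<omega> - (\<integral>\<omega>'. Y \<omega>' \<partial>M)) * (Z \<omega> - (\<integral>\<omega>'. Z \<omega>' \<partial>M)) \<partial>M)"

(* The tuple (T j), j : J, is an element of J -> real, represented by extensional functions
   (value undefined outside J).  On that set the pointwise order of functions is the
   coordinate-wise order, so mono_on says "non-decreasing in each coordinate".  The functions
   f, g are not required to be Borel: as usual, only the expectations have to exist. *)
definition associated_family :: "'a measure \<Rightarrow> 'l set \<Rightarrow> ('l \<Rightarrow> 'a \<Rightarrow> real) \<Rightarrow> bool" where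
  "associated_family M J T \<longleftrightarrow>
     (\<forall>f g :: ('l \<Rightarrow> real) \<Rightarrow> real.
        mono_on (J \<rightarrow>\<^sub>E UNIV) f \<longrightarrow> mono_on (J \<rightarrow>\<^sub>E UNIV) g \<longrightarrow>
        integrable M (\<lambda>\<omega>. f (\<lambda>j\<in>J. T j \<omega>)) \<longrightarrow>
        integrable M (\<lambda>\<omega>. g (\<lambda>j\<in>J. T j \<omega>)) \<longrightarrow>
        integrable M (\<lambda>\<omega>. f (\<lambda>j\<in>J. T j \<omega>) * g (\<lambda>j\<in>J. T j \<omega>)) \<longrightarrow>
        covariance M (\<lambda>\<omega>. f (\<lambda>j\<in>J. T j \<omega>)) (\<lambda>\<omega>. g (\<lambda>j\<in>J. T j \<omega>)) \<ge> 0)"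

definition associated_field :: "'a measure \<Rightarrow> ('l \<Rightarrow> 'a \<Rightarrow> real) \<Rightarrow> bool" where
  "associated_field M X \<longleftrightarrow> (\<forall>J. finite J \<longrightarrow> associated_family M J X)"

(* Strict stationarity: all finite-dimensional distributions are shift invariant. *)
definition strictly_stationary :: "'a measure \<Rightarrow> ('l::ab_group_add \<Rightarrow> 'a \<Rightarrow> real) \<Rightarrow> bool" where
  "strictly_stationary M X \<longleftrightarrow>
     (\<forall>J h. finite J \<longrightarrow>
        distr M (Pi\<^sub>M J (\<lambda>_. borel)) (\<lambda>\<omega>. \<lambda>j\<in>J. X (j + h) \<omega>) =
        distr M (Pi\<^sub>M J (\<lambda>_. borel)) (\<lambda>\<omega>. \<lambda>j\<in>J. X j \<omega>))"

end

theory Submission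
  imports Defs
begin

text \<open>
  For a bounded function f, the sum of f over the values of X along z is a sum over sites weighted by
  the number of visits, and the squares of these weights add up to the number V of
  self-intersections. In the independent case Hoeffding's inequality thus bounds the probability of
  a deviation \<open>\<epsilon> n\<close> by \<open>2 exp (- 2 \<epsilon>\<^sup>2 n\<^sup>2 / V)\<close>, which is eventually at most \<open>2 (ln n)\<^sup>-\<^sup>2\<close>. In the associated
  case, a C-Lipschitz f makes \<open>C x - f x\<close> and \<open>C x + f x\<close> non-decreasing, so association gives
  \<open>Cov (f X, f Y) \<le> C\<^sup>2 Cov (X, Y)\<close>; summability of the correlations then bounds the variance of the
  sum by a multiple of V, and Chebyshev's inequality gives a tail bound of order
  \<open>(ln n) powr - (1 + \<eta>)\<close>. Such tails are summable along the times \<open>\<lceil>\<rho> ^ j\<rceil>\<close>, between which averages of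
  bounded terms move by at most \<open>\<rho> - 1\<close>, so Borel-Cantelli yields almost sure convergence.
  Applied to half-line indicators at the rational quantiles, respectively to
  piecewise linear ramps with rational end points, this gives the convergence of the empirical
  distribution functions.
\<close>

section \<open>Almost sure convergence from logarithmic tail bounds\<close>

text \<open>A tail of order \<open>ln n powr - (1 + \<delta>)\<close> is not summable over all
  \<open>n\<close>, but at times growing like \<open>\<rho> ^ j\<close> it is of order
  \<open>j powr - (1 + \<delta>)\<close>. Since the terms are bounded by 1, the change of the sums
  between two such times is controlled for every outcome.\<close>

lemma (in prob_space) AE_averages_tendsto_0:
  fixes Y :: "nat \<Rightarrow> 'a \<Rightarrow> real"
  assumes [measurable]: "\<And>k. random_variable borel (Y k)"
    and bound: "\<And>k \<omega>. \<omega> \<in> space M \<Longrightarrow> \<bar>Y k \<omega>\<bar> \<le> 1"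
    and "\<delta> > 0"
    and tail: "\<And>\<epsilon>. \<epsilon> > 0 \<Longrightarrow>
      (\<lambda>n. prob {\<omega>\<in>space M. \<epsilon> * real n \<le> \<bar>\<Sum>k<n. Y k \<omega>\<bar>}) \<in> O(\<lambda>n. ln (real n) powr - (1 + \<delta>))"
  shows "AE \<omega> in M. (\<lambda>n. 1 / real n * (\<Sum>k<n. Y k \<omega>)) \<longlonglongrightarrow> 0"
proof -
  define S where "S n \<omega> = (\<Sum>k<n. Y k \<omega>)" for n \<omega>
  have [measurable]: "random_variable borel (S n)" for n
    unfolding S_def by measurable
  have diff: "\<bar>S n \<omega> - S m \<omega>\<bar> \<le> real (n - m)" if "m \<le> n" "\<omega> \<in> space M" for m n \<omega>
  proof -
    have "S n \<omega> - S m \<omega> = (\<Sum>k\<in>{..<n} - {..<m}. Y k \<omega>)"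
      unfolding S_def using that by (subst sum_diff) auto
    also have "{..<n} - {..<m} = {m..<n}" by auto
    also have "\<bar>\<Sum>k\<in>{m..<n}. Y k \<omega>\<bar> \<le> (\<Sum>k\<in>{m..<n}. 1)"
      by (rule order_trans[OF sum_abs sum_mono]) (use bound that in auto)
    finally show ?thesis by simp
  qed
  \<comment> \<open>One \<epsilon> pays for the deviation at the preceding time \<open>m j\<close>,
    the other for the terms between \<open>m j\<close> and \<open>n\<close>.\<close>
  have *: "AE \<omega> in M. eventually (\<lambda>n. \<bar>S n \<omega>\<bar> \<le> 2 * \<epsilon> * real n) sequentially" if "\<epsilon> > 0" for \<epsilon>
  proof -
    define \<rho> where "\<rho> = 1 + \<epsilon>"
    have \<rho>: "\<rho> > 1" using that by (simp add: \<rho>_def)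
    define m where "m j = nat \<lceil>\<rho> ^ j\<rceil>" for j
    have m_ge: "real (m j) \<ge> \<rho> ^ j" for j
      unfolding m_def by linarith
    have "filterlim (\<lambda>j. real (m j)) at_top sequentially"
    proof (rule filterlim_at_top_mono)
      show "filterlim (\<lambda>j. \<rho> ^ j) at_top sequentially"
        using \<rho> by (intro filterlim_at_infinity_imp_filterlim_at_top filterlim_realpow_sequentially_gt1)
          auto
    qed (use m_ge in auto)
    hence mlim: "filterlim m at_top sequentially"
      by (simp add: filterlim_sequentially_iff_filterlim_real)
    define A where "A j = {\<omega>\<in>space M. \<epsilon> * real (m j) \<le> \<bar>S (m j) \<omega>\<bar>}" for j
    have "(\<lambda>j. prob (A j)) \<in> O(\<lambda>j. ln (real (m j)) powr - (1 + \<delta>))"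
      unfolding A_def S_def by (rule landau_o.big.compose[OF tail mlim]) fact
    also have "(\<lambda>j. ln (real (m j)) powr - (1 + \<delta>)) \<in> O(\<lambda>j. (real j * ln \<rho>) powr - (1 + \<delta>))"
    proof (rule bigoI[where c = 1])
      show "eventually (\<lambda>j. norm (ln (real (m j)) powr - (1 + \<delta>))
              \<le> 1 * norm ((real j * ln \<rho>) powr - (1 + \<delta>))) sequentially"
        using eventually_gt_at_top[of 0]
      proof eventually_elim
        case (elim j)
        have "real j * ln \<rho> = ln (\<rho> ^ j)" using \<rho> by (simp add: ln_realpow)
        also have "\<dots> \<le> ln (real (m j))"
          using m_ge[of j] \<rho> by (smt (verit) ln_mono zero_less_power)
        finally show ?case using elim \<rho> \<open>\<delta> > 0\<close>
          by (auto intro!: powr_mono2')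
      qed
    qed
    also have "(\<lambda>j. (real j * ln \<rho>) powr - (1 + \<delta>)) \<in> O(\<lambda>j. real j powr - (1 + \<delta>))"
      using \<rho> by (simp add: powr_mult)
    finally have "summable (\<lambda>j. prob (A j))"
      by (rule summable_comparison_test_bigo[rotated]) (use \<open>\<delta> > 0\<close> in \<open>simp add: summable_real_powr_iff\<close>)
    then have "AE \<omega> in M. eventually (\<lambda>j. \<omega> \<in> space M - A j) sequentially"
      by (intro borel_cantelli_AE1) (auto simp: A_def less_top[symmetric])
    then show ?thesis
    proof (rule AE_mp, intro AE_I2 impI)
      fix \<omega> assume \<omega>: "\<omega> \<in> space M" and "eventually (\<lambda>j. \<omega> \<in> space M - A j) sequentially"
      then obtain J where J: "\<bar>S (m j) \<omega>\<bar> < \<epsilon> * real (m j)" if "j \<ge> J" for j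
        by (force simp: eventually_sequentially A_def not_le)
      show "eventually (\<lambda>n. \<bar>S n \<omega>\<bar> \<le> 2 * \<epsilon> * real n) sequentially"
        using eventually_ge_at_top[of "nat \<lceil>\<rho> ^ J\<rceil>"]
      proof eventually_elim
        case (elim n)
        hence nJ: "\<rho> ^ J \<le> real n" by linarith
        obtain i where i: "real n < \<rho> ^ i" using real_arch_pow[OF \<rho>] by blast
        \<comment> \<open>The last exponent with \<open>\<rho> ^ j \<le> n\<close>; the bound
          \<open>bdd\<close> makes a greatest one exist.\<close>
        define j where "j = (GREATEST j. \<rho> ^ j \<le> real n)"
        have bdd: "y \<le> i" if "\<rho> ^ y \<le> real n" for y
        proof (rule ccontr)
          assume "\<not> y \<le> i"
          hence "\<rho> ^ i \<le> \<rho> ^ y" using \<rho> by (intro power_increasing) auto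
          with i that show False by linarith
        qed
        have j1: "\<rho> ^ j \<le> real n" unfolding j_def by (rule GreatestI_nat[of "\<lambda>j. \<rho> ^ j \<le> real n", OF nJ bdd])
        have "J \<le> j" unfolding j_def by (rule Greatest_le_nat[of "\<lambda>j. \<rho> ^ j \<le> real n", OF nJ bdd])
        have j2: "real n < \<rho> ^ Suc j"
        proof (rule ccontr)
          assume "\<not> real n < \<rho> ^ Suc j"
          hence "Suc j \<le> j" unfolding j_def by (intro Greatest_le_nat[of "\<lambda>j. \<rho> ^ j \<le> real n", OF _ bdd]) auto
          thus False by simp
        qed
        \<comment> \<open>Since \<open>n\<close> is an integer not below \<open>\<rho> ^ j\<close>,
          rounding up does not pass it.\<close>
        have mn: "m j \<le> n" using j1 unfolding m_def by linarith
        have "real (n - m j) \<le> \<rho> ^ Suc j - \<rho> ^ j" using m_ge[of j] j2 mn by linarith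
        also have "\<dots> = \<epsilon> * \<rho> ^ j" by (simp add: \<rho>_def algebra_simps)
        also have "\<dots> \<le> \<epsilon> * real n" using j1 that by simp
        finally have "\<bar>S n \<omega> - S (m j) \<omega>\<bar> \<le> \<epsilon> * real n" using diff[OF mn \<omega>] by linarith
        moreover have "\<epsilon> * real (m j) \<le> \<epsilon> * real n" using mn that by simp
        ultimately show ?case using J[OF \<open>J \<le> j\<close>] by linarith
      qed
    qed
  qed
  \<comment> \<open>Countably many tolerances suffice, so the exceptional null sets can be
    united.\<close>
  have "AE \<omega> in M. \<forall>i. eventually (\<lambda>n. \<bar>S n \<omega>\<bar> \<le> 2 * inverse (real (Suc i)) * real n) sequentially"
    unfolding AE_all_countable using * by simp
  then show ?thesis
  proof (rule AE_mp, intro AE_I2 impI)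
    fix \<omega>
    assume ev: "\<forall>i. eventually (\<lambda>n. \<bar>S n \<omega>\<bar> \<le> 2 * inverse (real (Suc i)) * real n) sequentially"
    show "(\<lambda>n. 1 / real n * (\<Sum>k<n. Y k \<omega>)) \<longlonglongrightarrow> 0"
    proof (rule tendstoI)
      fix e :: real assume "e > 0"
      then obtain i where i: "inverse (real (Suc i)) < e / 2"
        using reals_Archimedean[of "e / 2"] by auto
      show "eventually (\<lambda>n. dist (1 / real n * (\<Sum>k<n. Y k \<omega>)) 0 < e) sequentially"
        using ev[rule_format, of i] eventually_gt_at_top[of 0]
      proof eventually_elim
        case (elim n)
        have "2 * inverse (real (Suc i)) * real n < e * real n"
          using i elim by (intro mult_strict_right_mono) auto
        hence "\<bar>S n \<omega>\<bar> < e * real n" using elim by linarith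
        thus ?case using elim by (simp add: S_def abs_divide field_simps)
      qed
    qed
  qed
qed

section \<open>Convergence of distribution functions at quantiles\<close>

text \<open>\<open>I\<close> is the generalized inverse of \<open>cdf M\<close>. Rational levels
  keep the set countable and include every grid level \<open>i / N\<close> with
  \<open>0 < i < N\<close>.\<close>

definition (in cdf_distribution) quantiles :: "real set" where
  "quantiles = I ` (\<rat> \<inter> {0<..<1})"

lemma (in cdf_distribution) countable_quantiles: "countable quantiles"
  by (simp add: quantiles_def countable_rat)

text \<open>In applications \<open>L\<close> consists of the left limits of \<open>H\<close>, or is \<open>H\<close> itself when \<open>M\<close> has no atoms.\<close>
lemma (in cdf_distribution) uniform_limit_cdf_if_tendsto_at_quantiles:
  fixes H L :: "nat \<Rightarrow> real \<Rightarrow> real"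
  assumes mono: "\<And>n. mono (H n)" and H0: "\<And>n s. 0 \<le> H n s" and H1: "\<And>n s. H n s \<le> 1"
    and HL: "\<And>n s q. s < q \<Longrightarrow> H n s \<le> L n q"
    and H: "\<And>q. q \<in> quantiles \<Longrightarrow> (\<lambda>n. H n q) \<longlonglongrightarrow> cdf M q"
    and L: "\<And>q. q \<in> quantiles \<Longrightarrow> (\<lambda>n. L n q) \<longlonglongrightarrow> measure M {..<q}"
  shows "uniform_limit UNIV H (cdf M) sequentially"
proof -
  define q where "q N i = I (real i / real N)" for N i :: nat
  have quantile: "q N i \<in> quantiles" if "0 < i" "i < N" for i N
    using that by (auto simp: q_def quantiles_def)
  have ge: "real i / real N \<le> cdf M x \<longleftrightarrow> q N i \<le> x" if "0 < i" "i < N" for i N x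
    unfolding q_def by (rule pseudoinverse) (use that in \<open>auto simp: field_simps\<close>)
  \<comment> \<open>Left of the quantile the distribution function stays below the level, and its
    left limit there is the mass of the open half-line.\<close>
  have left: "measure M {..<q N i} \<le> real i / real N" if "0 < i" "i < N" for i N
  proof (rule tendsto_upperbound[OF cdf_at_left])
    show "eventually (\<lambda>x. cdf M x \<le> real i / real N) (at_left (q N i))"
      using ge[OF that] by (auto simp: eventually_at_filter not_le intro!: always_eventually)
        (meson leD linorder_le_less_linear order_less_imp_le)
  qed simp
  show "uniform_limit UNIV H (cdf M) sequentially"
  proof (rule uniform_limitI)
    fix e :: real assume "e > 0"
    then obtain N0 where N0: "inverse (real (Suc N0)) < e / 2"
      using reals_Archimedean[of "e / 2"] by auto
    \<comment> \<open>The mesh \<open>1 / N\<close> and the error at a grid point each take less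
      than \<open>e / 2\<close>.\<close>
    define N where "N = Suc N0"
    have N: "N > 0" "1 / real N < e / 2" using N0 by (auto simp: N_def inverse_eq_divide)
    have "eventually (\<lambda>n. \<bar>H n (q N i) - cdf M (q N i)\<bar> < e / 2) sequentially" if "0 < i" "i < N" for i
      using tendstoD[OF H[OF quantile[OF that]], of "e / 2"] \<open>e > 0\<close> by (auto simp: dist_real_def)
    moreover have "eventually (\<lambda>n. \<bar>L n (q N i) - measure M {..<q N i}\<bar> < e / 2) sequentially"
      if "0 < i" "i < N" for i
      using tendstoD[OF L[OF quantile[OF that]], of "e / 2"] \<open>e > 0\<close> by (auto simp: dist_real_def)
    ultimately have "eventually (\<lambda>n. \<forall>i\<in>{0<..<N}. \<bar>H n (q N i) - cdf M (q N i)\<bar> < e / 2 \<and>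
        \<bar>L n (q N i) - measure M {..<q N i}\<bar> < e / 2) sequentially"
      by (simp add: eventually_ball_finite_distrib eventually_conj_iff)
    then show "eventually (\<lambda>n. \<forall>s\<in>UNIV. dist (H n s) (cdf M s) < e) sequentially"
    proof eventually_elim
      case (elim n)
      show ?case
      proof
        fix s
        \<comment> \<open>The cell with \<open>i / N \<le> cdf M s \<le> Suc i / N\<close>; the cap
          \<open>N - 1\<close> takes care of \<open>cdf M s = 1\<close>.\<close>
        define i where "i = min (N - 1) (nat \<lfloor>N * cdf M s\<rfloor>)"
        have c: "0 \<le> N * cdf M s" "N * cdf M s \<le> N"
          by (simp_all add: cdf_nonneg cdf_bounded_prob mult_left_le)
        have iN: "i < N" using N by (simp add: i_def)
        have "real i \<le> N * cdf M s" using c(1) unfolding i_def by linarith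
        hence i1: "real i / real N \<le> cdf M s" using N by (simp add: field_simps)
        have "N * cdf M s \<le> Suc i" using c N unfolding i_def by linarith
        hence i2: "cdf M s \<le> real (Suc i) / real N" using N by (simp add: field_simps)
        have N2: "real (Suc i) / real N = real i / real N + 1 / real N"
          using N by (simp add: field_simps)
        have lower: "H n s > cdf M s - e"
        proof (cases "i = 0")
          case True
          then have "real i / real N = 0" by simp
          then show ?thesis using H0[of n s] N(2) i2 N2 \<open>e > 0\<close> by linarith
        next
          case False
          hence "q N i \<le> s" using ge[of i N s] iN i1 by auto
          hence "H n (q N i) \<le> H n s" using mono[of n] by (auto simp: mono_def)
          moreover have "real i / real N \<le> cdf M (q N i)" using ge[of i N "q N i"] iN False by auto
          moreover have "\<bar>H n (q N i) - cdf M (q N i)\<bar> < e / 2" using elim iN False by simp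
          ultimately show ?thesis using N i2 N2 by linarith
        qed
        \<comment> \<open>An atom at the next quantile may carry more mass than
          \<open>1 / N\<close>, so the comparison to the right of \<open>s\<close> uses
          \<open>L\<close> and the open half-line. In the last cell \<open>H \<le> 1\<close>
          suffices.\<close>
        have upper: "H n s < cdf M s + e"
        proof (cases "Suc i < N")
          case False
          hence "real (Suc i) / real N \<ge> 1" using N by (simp add: field_simps)
          thus ?thesis using H1[of n s] N i1 N2 \<open>e > 0\<close> by linarith
        next
          case True
          have "\<bar>L n (q N (Suc i)) - measure M {..<q N (Suc i)}\<bar> < e / 2" using elim True by simp
          moreover have "measure M {..<q N (Suc i)} \<le> real (Suc i) / real N" using left True by blast
          moreover have "\<not> real (Suc i) / real N \<le> cdf M s"
          proof -
            have "i = nat \<lfloor>N * cdf M s\<rfloor>" using True unfolding i_def by linarith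
            hence "N * cdf M s < real (Suc i)" using c(1) by linarith
            thus ?thesis using N by (simp add: field_simps)
          qed
          hence "H n s \<le> L n (q N (Suc i))" using ge[of "Suc i" N s] True by (intro HL) auto
          ultimately show ?thesis using N N2 i1 \<open>e > 0\<close> by linarith
        qed
        show "dist (H n s) (cdf M s) < e" using lower upper by (auto simp: dist_real_def)
      qed
    qed
  qed
qed

section \<open>Local times and the independent case\<close>

definition visits :: "(nat \<Rightarrow> 'l) \<Rightarrow> nat \<Rightarrow> 'l \<Rightarrow> nat" where
  "visits z n a = card {k. k < n \<and> z k = a}"

lemma sum_along_eq_sum_visits:
  fixes f :: "'l \<Rightarrow> real"
  shows "(\<Sum>k<n. f (z k)) = (\<Sum>a\<in>z ` {..<n}. real (visits z n a) * f a)"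
proof -
  have "(\<Sum>k<n. f (z k)) = (\<Sum>a\<in>z ` {..<n}. \<Sum>k\<in>{k\<in>{..<n}. z k = a}. f (z k))"
    by (rule sum.image_gen) simp
  also have "\<dots> = (\<Sum>a\<in>z ` {..<n}. real (visits z n a) * f a)"
    by (intro sum.cong) (auto simp: visits_def)
  finally show ?thesis .
qed

text \<open>For each time \<open>j\<close> the matching \<open>k\<close> are the visits to
  \<open>z j\<close>; regrouping the times \<open>j\<close> by site contributes the same count as a
  second factor.\<close>

lemma self_intersections_eq_sum_visits:
  "real (self_intersections z n) = (\<Sum>a\<in>z ` {..<n}. (real (visits z n a))\<^sup>2)"
proof -
  have "{(j, k). j < n \<and> k < n \<and> z j = z k} = (SIGMA j:{..<n}. {k. k < n \<and> z k = z j})"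
    by auto
  hence "self_intersections z n = (\<Sum>j<n. visits z n (z j))"
    by (simp add: self_intersections_def visits_def card_SigmaI)
  thus ?thesis
    using sum_along_eq_sum_visits[of "\<lambda>a. real (visits z n a)" z n] by (simp add: power2_eq_square)
qed

text \<open>The pair \<open>(0, 0)\<close> always counts. Positivity lets this number stand in the
  denominator of the exponential bound.\<close>

lemma self_intersections_pos:
  assumes "n > 0"
  shows "self_intersections z n > 0"
proof -
  have "finite {(j, k). j < n \<and> k < n \<and> z j = z k}"
    by (rule finite_subset[of _ "{..<n} \<times> {..<n}"]) auto
  moreover have "(0, 0) \<in> {(j, k). j < n \<and> k < n \<and> z j = z k}"
    using assms by simp
  ultimately show ?thesis
    unfolding self_intersections_def card_gt_0_iff by blast
qed

section \<open>Exponential tail bounds for independent fields\<close>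

context prob_space
begin

text \<open>Times at the same site repeat the same variable, so Hoeffding's inequality is applied to
  sites: the summands are independent with values in \<open>[0, N a]\<close>, and the squared
  interval lengths add up to the number of self-intersections.\<close>

lemma Hoeffding_along:
  fixes X :: "'l \<Rightarrow> 'a \<Rightarrow> real" and f :: "real \<Rightarrow> real"
  assumes indep: "indep_vars (\<lambda>_. borel) X UNIV"
    and f [measurable]: "f \<in> borel_measurable borel"
    and f01: "\<And>x. 0 \<le> f x" "\<And>x. f x \<le> 1"
    and "n > 0" "e \<ge> 0"
  shows "prob {\<omega>\<in>space M. e \<le> \<bar>\<Sum>k<n. (f (X (z k) \<omega>) - expectation (\<lambda>\<omega>. f (X (z k) \<omega>)))\<bar>}
    \<le> 2 * exp (- 2 * e\<^sup>2 / real (self_intersections z n))"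
proof -
  have [measurable]: "random_variable borel (X l)" for l
    using indep by (auto simp: indep_vars_def)
  define N where "N a = real (visits z n a)" for a
  define m where "m l = expectation (\<lambda>\<omega>. f (X l \<omega>))" for l
  have V: "(\<Sum>a\<in>z ` {..<n}. (N a - 0)\<^sup>2) = real (self_intersections z n)"
    by (simp add: self_intersections_eq_sum_visits N_def)
  interpret Hoeffding_ineq M "z ` {..<n}" "\<lambda>a \<omega>. N a * f (X a \<omega>)" "\<lambda>_. 0" N
    "\<Sum>a\<in>z ` {..<n}. N a * m a"
  proof unfold_locales
    show "indep_vars (\<lambda>_. borel) (\<lambda>a \<omega>. N a * f (X a \<omega>)) (z ` {..<n})"
      using indep_vars_compose2[OF indep_vars_subset[OF indep], where Y = "\<lambda>a x. N a * f x"] by simp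
    show "(\<Sum>a\<in>z ` {..<n}. N a * m a) \<equiv> \<Sum>a\<in>z ` {..<n}. expectation (\<lambda>\<omega>. N a * f (X a \<omega>))"
      by (simp add: m_def)
  qed (use f01 in \<open>auto simp: N_def intro!: mult_left_le\<close>)
  have "(\<Sum>k<n. (f (X (z k) \<omega>) - m (z k))) =
      (\<Sum>a\<in>z ` {..<n}. N a * f (X a \<omega>)) - (\<Sum>a\<in>z ` {..<n}. N a * m a)" for \<omega>
    using sum_along_eq_sum_visits[of "\<lambda>a. f (X a \<omega>) - m a" z n]
    by (simp add: N_def right_diff_distrib sum_subtractf)
  thus ?thesis
    using Hoeffding_ineq_abs_ge[OF \<open>e \<ge> 0\<close>, unfolded V] self_intersections_pos[OF \<open>n > 0\<close>, of z]
    by (simp add: m_def)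
qed

text \<open>With the constant \<open>\<epsilon>\<^sup>2\<close> in the little-o hypothesis,
  \<open>V * ln (ln n) \<le> (\<epsilon> * n)\<^sup>2\<close>, so the exponent in Hoeffding's bound
  is at most \<open>- 2 * ln (ln n)\<close>.\<close>

lemma tail_bound_indep:
  fixes X :: "'l \<Rightarrow> 'a \<Rightarrow> real" and f :: "real \<Rightarrow> real"
  assumes indep: "indep_vars (\<lambda>_. borel) X UNIV"
    and f [measurable]: "f \<in> borel_measurable borel"
    and f01: "\<And>x. 0 \<le> f x" "\<And>x. f x \<le> 1"
    and V: "(\<lambda>n. real (self_intersections z n)) \<in> o(\<lambda>n. (real n)\<^sup>2 * inverse (ln (ln (real n))))"
    and "\<epsilon> > 0"
  shows "(\<lambda>n. prob {\<omega>\<in>space M.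
      \<epsilon> * real n \<le> \<bar>\<Sum>k<n. (f (X (z k) \<omega>) - expectation (\<lambda>\<omega>. f (X (z k) \<omega>)))\<bar>})
    \<in> O(\<lambda>n. ln (real n) powr - (1 + 1))"
proof (rule bigoI[where c = 2])
  \<comment> \<open>Beyond \<open>exp 1\<close> the iterated logarithm is positive and can be
    multiplied across.\<close>
  have "eventually (\<lambda>n. real n > exp 1) sequentially"
    using filterlim_real_sequentially by (simp add: filterlim_at_top_dense)
  moreover have "eventually (\<lambda>n. norm (real (self_intersections z n))
      \<le> \<epsilon>\<^sup>2 * norm ((real n)\<^sup>2 * inverse (ln (ln (real n))))) sequentially"
    using landau_o.smallD[OF V, of "\<epsilon>\<^sup>2"] \<open>\<epsilon> > 0\<close> by simp
  ultimately show "eventually (\<lambda>n. norm (prob {\<omega>\<in>space M.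
      \<epsilon> * real n \<le> \<bar>\<Sum>k<n. (f (X (z k) \<omega>) - expectation (\<lambda>\<omega>. f (X (z k) \<omega>)))\<bar>})
    \<le> 2 * norm (ln (real n) powr - (1 + 1))) sequentially"
  proof eventually_elim
    case (elim n)
    have "n > 0" using elim(1) by (cases n) (auto simp: not_less)
    have ln1: "ln (real n) > 1"
      using elim(1) \<open>n > 0\<close> ln_less_cancel_iff[of "exp 1" "real n"] by simp
    hence lnln: "ln (ln (real n)) > 0" by simp
    define V where "V = real (self_intersections z n)"
    have "V > 0" using self_intersections_pos[OF \<open>n > 0\<close>, of z] by (simp add: V_def)
    have "V * ln (ln (real n)) \<le> (\<epsilon> * real n)\<^sup>2"
    proof -
      have "V \<le> \<epsilon>\<^sup>2 * ((real n)\<^sup>2 / ln (ln (real n)))"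
        using elim(2) lnln by (simp add: V_def divide_inverse)
      thus ?thesis
        using lnln by (simp add: pos_le_divide_eq power_mult_distrib)
    qed
    hence "- 2 * (\<epsilon> * real n)\<^sup>2 / V \<le> - (2 * ln (ln (real n)))"
      using \<open>V > 0\<close> by (simp add: pos_divide_le_eq pos_le_divide_eq mult.commute)
    hence "exp (- 2 * (\<epsilon> * real n)\<^sup>2 / V) \<le> exp (- (2 * ln (ln (real n))))"
      by (subst exp_le_cancel_iff)
    also have "\<dots> = ln (real n) powr - (1 + 1)"
      using ln1 by (simp add: powr_def)
    finally have "exp (- 2 * (\<epsilon> * real n)\<^sup>2 / V) \<le> ln (real n) powr - (1 + 1)" .
    moreover have "prob {\<omega>\<in>space M. \<epsilon> * real n
          \<le> \<bar>\<Sum>k<n. (f (X (z k) \<omega>) - expectation (\<lambda>\<omega>. f (X (z k) \<omega>)))\<bar>}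
        \<le> 2 * exp (- 2 * (\<epsilon> * real n)\<^sup>2 / V)"
      unfolding V_def using \<open>\<epsilon> > 0\<close> by (intro Hoeffding_along[OF indep f f01 \<open>n > 0\<close>]) simp
    ultimately show ?case
      by (simp only: real_norm_def abs_of_nonneg measure_nonneg powr_ge_zero)
  qed
qed

end

section \<open>Associated fields\<close>

text \<open>Grouped by sites, the double sum has weights \<open>N a * N b\<close>, at most the mean
  of the two squares. With one site fixed the differences to the others are distinct, so each row or
  column of \<open>r\<close> sums to at most \<open>infsum r UNIV\<close>.\<close>

lemma sum_differences_le:
  fixes r :: "'l::ab_group_add \<Rightarrow> real" and z :: "nat \<Rightarrow> 'l"
  assumes r: "\<And>l. 0 \<le> r l" "r summable_on UNIV"
  shows "(\<Sum>j<n. \<Sum>k<n. r (z j - z k)) \<le> infsum r UNIV * real (self_intersections z n)"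
proof -
  define A where "A = z ` {..<n}"
  define N where "N a = real (visits z n a)" for a
  have le: "(\<Sum>b\<in>A. r (h b)) \<le> infsum r UNIV" if "inj h" for h :: "'l \<Rightarrow> 'l"
  proof -
    have "(\<Sum>b\<in>A. r (h b)) = sum r (h ` A)"
      using that by (subst sum.reindex) (auto intro: inj_on_subset)
    also have "\<dots> \<le> infsum r UNIV"
      by (rule finite_sum_le_infsum) (use r in \<open>auto simp: A_def\<close>)
    finally show ?thesis .
  qed
  \<comment> \<open>A general injective \<open>h a\<close> lets one estimate serve both halves,
    whichever argument of the difference is held fixed.\<close>
  have half: "(\<Sum>a\<in>A. \<Sum>b\<in>A. (N a)\<^sup>2 / 2 * r (h a b))
      \<le> infsum r UNIV * real (self_intersections z n) / 2"
    if "\<And>a. inj (h a)" for h :: "'l \<Rightarrow> 'l \<Rightarrow> 'l"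
  proof -
    have "(\<Sum>a\<in>A. \<Sum>b\<in>A. (N a)\<^sup>2 / 2 * r (h a b)) = (\<Sum>a\<in>A. (N a)\<^sup>2 / 2 * (\<Sum>b\<in>A. r (h a b)))"
      by (simp add: sum_distrib_left)
    also have "\<dots> \<le> (\<Sum>a\<in>A. (N a)\<^sup>2 / 2 * infsum r UNIV)"
      by (intro sum_mono mult_left_mono le that) auto
    also have "\<dots> = infsum r UNIV * real (self_intersections z n) / 2"
      by (simp add: self_intersections_eq_sum_visits A_def N_def sum_distrib_left sum_divide_distrib mult_ac)
    finally show ?thesis .
  qed
  have "(\<Sum>j<n. \<Sum>k<n. r (z j - z k)) = (\<Sum>j<n. \<Sum>b\<in>A. N b * r (z j - b))"
    unfolding A_def N_def by (intro sum.cong refl sum_along_eq_sum_visits[of "\<lambda>b. r (_ - b)"])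
  also have "\<dots> = (\<Sum>a\<in>A. N a * (\<Sum>b\<in>A. N b * r (a - b)))"
    unfolding A_def N_def by (rule sum_along_eq_sum_visits)
  also have "\<dots> = (\<Sum>a\<in>A. \<Sum>b\<in>A. N a * N b * r (a - b))"
    by (simp add: sum_distrib_left mult_ac)
  also have "\<dots> \<le> (\<Sum>a\<in>A. \<Sum>b\<in>A. (N a)\<^sup>2 / 2 * r (a - b) + (N b)\<^sup>2 / 2 * r (a - b))"
  proof (intro sum_mono)
    fix a b
    have "N a * N b \<le> (N a)\<^sup>2 / 2 + (N b)\<^sup>2 / 2"
      using sum_squares_bound[of "N a" "N b"] by simp
    from mult_right_mono[OF this r(1)[of "a - b"]]
    show "N a * N b * r (a - b) \<le> (N a)\<^sup>2 / 2 * r (a - b) + (N b)\<^sup>2 / 2 * r (a - b)"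
      by (simp add: distrib_right)
  qed
  also have "\<dots> = (\<Sum>a\<in>A. \<Sum>b\<in>A. (N a)\<^sup>2 / 2 * r (a - b)) + (\<Sum>b\<in>A. \<Sum>a\<in>A. (N b)\<^sup>2 / 2 * r (a - b))"
    by (simp only: sum.distrib) (simp only: sum.swap[of "\<lambda>b a. (N b)\<^sup>2 / 2 * r (a - b)"])
  also have "\<dots> \<le> infsum r UNIV * real (self_intersections z n)"
    using half[of "\<lambda>a b. a - b"] half[of "\<lambda>b a. a - b"] by (simp add: inj_def)
  finally show ?thesis .
qed

text \<open>Association of the sites \<open>{l, m}\<close>, tested with functions of one coordinate
  each; the case \<open>l = m\<close> is included.\<close>

lemma associated_field_covariance_nonneg:
  assumes "associated_field M X" "mono \<phi>" "mono \<psi>"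
    and "integrable M (\<lambda>\<omega>. \<phi> (X l \<omega>))" "integrable M (\<lambda>\<omega>. \<psi> (X m \<omega>))"
    and "integrable M (\<lambda>\<omega>. \<phi> (X l \<omega>) * \<psi> (X m \<omega>))"
  shows "0 \<le> covariance M (\<lambda>\<omega>. \<phi> (X l \<omega>)) (\<lambda>\<omega>. \<psi> (X m \<omega>))"
proof -
  have "associated_family M {l, m} X"
    using assms(1) by (simp add: associated_field_def)
  moreover have "mono_on ({l, m} \<rightarrow>\<^sub>E UNIV) (\<lambda>T. \<phi> (T l))" "mono_on ({l, m} \<rightarrow>\<^sub>E UNIV) (\<lambda>T. \<psi> (T m))"
    using assms(2,3) by (auto simp: mono_on_def mono_def le_fun_def)
  ultimately show ?thesis
    using assms(4-6)
      associated_family_def[THEN iffD1, rule_format,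
        of M "{l, m}" X "\<lambda>T. \<phi> (T l)" "\<lambda>T. \<psi> (T m)"]
    by simp
qed

section \<open>Covariance inequalities and Chebyshev bounds for associated fields\<close>

context prob_space
begin

lemma covariance_eq:
  assumes "integrable M Y" "integrable M Z" "integrable M (\<lambda>\<omega>. Y \<omega> * Z \<omega>)"
  shows "covariance M Y Z = expectation (\<lambda>\<omega>. Y \<omega> * Z \<omega>) - expectation Y * expectation Z"
proof -
  have "covariance M Y Z = expectation (\<lambda>\<omega>. Y \<omega> * Z \<omega> - expectation Z * Y \<omega> - expectation Y * Z \<omega>
      + expectation Y * expectation Z)"
    unfolding covariance_def by (intro Bochner_Integration.integral_cong) (auto simp: algebra_simps)
  thus ?thesis using assms by (simp add: prob_space)
qed

lemma integrable_mult_square_integrable: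
  fixes Y Z :: "'a \<Rightarrow> real"
  assumes [measurable]: "random_variable borel Y" "random_variable borel Z"
    and "integrable M (\<lambda>\<omega>. (Y \<omega>)\<^sup>2)" "integrable M (\<lambda>\<omega>. (Z \<omega>)\<^sup>2)"
  shows "integrable M (\<lambda>\<omega>. Y \<omega> * Z \<omega>)"
proof (rule Bochner_Integration.integrable_bound[where f = "\<lambda>\<omega>. (Y \<omega>)\<^sup>2 + (Z \<omega>)\<^sup>2"])
  have "\<bar>Y \<omega> * Z \<omega>\<bar> \<le> (Y \<omega>)\<^sup>2 + (Z \<omega>)\<^sup>2" for \<omega>
  proof -
    have "0 \<le> \<bar>Y \<omega> * Z \<omega>\<bar>" by simp
    moreover have "2 * \<bar>Y \<omega> * Z \<omega>\<bar> \<le> (Y \<omega>)\<^sup>2 + (Z \<omega>)\<^sup>2"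
      using sum_squares_bound[of "\<bar>Y \<omega>\<bar>" "\<bar>Z \<omega>\<bar>"] by (simp add: abs_mult)
    ultimately show ?thesis by linarith
  qed
  thus "AE \<omega> in M. norm (Y \<omega> * Z \<omega>) \<le> norm ((Y \<omega>)\<^sup>2 + (Z \<omega>)\<^sup>2)" by simp
qed (use assms in auto)

text \<open>Both \<open>C * x - f x\<close> and \<open>C * x + f x\<close> are non-decreasing.
  Pairing them in the two possible orders gives two nonnegative covariances; in their sum the mixed
  terms cancel, leaving twice the difference of the two sides.\<close>

lemma associated_covariance_Lipschitz:
  fixes X :: "'l \<Rightarrow> 'a \<Rightarrow> real"
  assumes assoc: "associated_field M X"
    and [measurable]: "\<And>l. random_variable borel (X l)"
    and sq: "\<And>l. integrable M (\<lambda>\<omega>. (X l \<omega>)\<^sup>2)"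
    and lip: "\<And>x y. \<bar>f x - f y\<bar> \<le> C * \<bar>x - y\<bar>"
    and [measurable]: "f \<in> borel_measurable borel"
    and bound: "\<And>x. \<bar>f x\<bar> \<le> B"
  shows "covariance M (\<lambda>\<omega>. f (X l \<omega>)) (\<lambda>\<omega>. f (X m \<omega>)) \<le> C\<^sup>2 * covariance M (X l) (X m)"
proof -
  have f: "integrable M (\<lambda>\<omega>. f (X l \<omega>))" for l
    by (rule integrable_const_bound[where B = B]) (use bound in auto)
  have ff: "integrable M (\<lambda>\<omega>. (f (X l \<omega>))\<^sup>2)" for l
  proof (rule integrable_const_bound[where B = "B\<^sup>2"])
    show "AE \<omega> in M. norm ((f (X l \<omega>))\<^sup>2) \<le> B\<^sup>2"
      using power_mono[OF bound abs_ge_zero, of _ 2] by simp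
  qed simp
  have X: "integrable M (X l)" for l
    by (rule square_integrable_imp_integrable[OF _ sq]) simp
  have prods: "integrable M (\<lambda>\<omega>. X l \<omega> * X m \<omega>)" "integrable M (\<lambda>\<omega>. X l \<omega> * f (X m \<omega>))"
    "integrable M (\<lambda>\<omega>. f (X l \<omega>) * X m \<omega>)" "integrable M (\<lambda>\<omega>. f (X l \<omega>) * f (X m \<omega>))" for l m
    by (intro integrable_mult_square_integrable sq ff; simp)+
  have mono: "mono (\<lambda>x. C * x - f x)" "mono (\<lambda>x. C * x + f x)"
  proof -
    have "C * x - f x \<le> C * y - f y \<and> C * x + f x \<le> C * y + f y" if "x \<le> y" for x y
      using lip[of x y] that by (auto simp: abs_le_iff algebra_simps)
    thus "mono (\<lambda>x. C * x - f x)" "mono (\<lambda>x. C * x + f x)" by (auto simp: mono_def)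
  qed
  have e1: "(C * X l \<omega> - f (X l \<omega>)) * (C * X m \<omega> + f (X m \<omega>)) =
      C\<^sup>2 * (X l \<omega> * X m \<omega>) + C * (X l \<omega> * f (X m \<omega>)) - C * (f (X l \<omega>) * X m \<omega>)
      - f (X l \<omega>) * f (X m \<omega>)" for \<omega>
    by (simp add: algebra_simps power2_eq_square)
  have e2: "(C * X l \<omega> + f (X l \<omega>)) * (C * X m \<omega> - f (X m \<omega>)) =
      C\<^sup>2 * (X l \<omega> * X m \<omega>) - C * (X l \<omega> * f (X m \<omega>)) + C * (f (X l \<omega>) * X m \<omega>)
      - f (X l \<omega>) * f (X m \<omega>)" for \<omega>
    by (simp add: algebra_simps power2_eq_square)
  have "0 \<le> covariance M (\<lambda>\<omega>. C * X l \<omega> - f (X l \<omega>)) (\<lambda>\<omega>. C * X m \<omega> + f (X m \<omega>))"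
    by (rule associated_field_covariance_nonneg[OF assoc mono]; (subst e1)?) (simp_all add: X f prods)
  moreover have "0 \<le> covariance M (\<lambda>\<omega>. C * X l \<omega> + f (X l \<omega>)) (\<lambda>\<omega>. C * X m \<omega> - f (X m \<omega>))"
    by (rule associated_field_covariance_nonneg[OF assoc mono(2,1)]; (subst e2)?) (simp_all add: X f prods)
  ultimately show ?thesis
    by (simp add: covariance_eq e1 e2 X f prods algebra_simps power2_eq_square)
qed

text \<open>Shifting the pair \<open>(l - m, 0)\<close> by \<open>m\<close> gives
  \<open>(l, m)\<close>, and stationarity equates the two joint laws.\<close>

lemma stationary_expectation_mult:
  fixes X :: "'l::ab_group_add \<Rightarrow> 'a \<Rightarrow> real"
  assumes stat: "strictly_stationary M X"
    and [measurable]: "\<And>l. random_variable borel (X l)"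
  shows "expectation (\<lambda>\<omega>. X l \<omega> * X m \<omega>) = expectation (\<lambda>\<omega>. X (l - m) \<omega> * X 0 \<omega>)"
proof -
  define J where "J = {l - m, 0}"
  define P where "P = Pi\<^sub>M J (\<lambda>_. borel :: real measure)"
  have g [measurable]: "(\<lambda>x. x (l - m) * x 0) \<in> borel_measurable P"
    unfolding P_def J_def by measurable
  have meas: "(\<lambda>\<omega>. \<lambda>j\<in>J. X (j + h) \<omega>) \<in> measurable M P" for h
    unfolding P_def by measurable
  have *: "(\<integral>x. x (l - m) * x 0 \<partial>distr M P (\<lambda>\<omega>. \<lambda>j\<in>J. X (j + h) \<omega>)) =
      expectation (\<lambda>\<omega>. X (l - m + h) \<omega> * X h \<omega>)" for h
    by (subst integral_distr[OF meas g]) (simp add: J_def)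
  have "finite J" by (simp add: J_def)
  hence "distr M P (\<lambda>\<omega>. \<lambda>j\<in>J. X (j + m) \<omega>) = distr M P (\<lambda>\<omega>. \<lambda>j\<in>J. X (j + 0) \<omega>)"
    using stat by (simp add: strictly_stationary_def P_def)
  with *[of m] *[of 0] show ?thesis by simp
qed

text \<open>The square expands into covariances of \<open>f (X l)\<close>, each at most
  \<open>C\<^sup>2\<close> times the covariance of the underlying variables. By stationarity the
  latter depend only on the difference of the sites, so \<open>sum_differences_le\<close>
  applies.\<close>

lemma second_moment_along:
  fixes X :: "'l::ab_group_add \<Rightarrow> 'a \<Rightarrow> real"
  assumes stat: "strictly_stationary M X" and assoc: "associated_field M X"
    and [measurable]: "\<And>l. random_variable borel (X l)"
    and sq: "\<And>l. integrable M (\<lambda>\<omega>. (X l \<omega>)\<^sup>2)"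
    and same: "\<And>l. expectation (X l) = \<mu>"
    and summ: "(\<lambda>l. expectation (\<lambda>\<omega>. X l \<omega> * X 0 \<omega>)) summable_on UNIV"
    and lip: "\<And>x y. \<bar>f x - f y\<bar> \<le> C * \<bar>x - y\<bar>"
    and [measurable]: "f \<in> borel_measurable borel"
    and bound: "\<And>x. \<bar>f x\<bar> \<le> B"
  shows "expectation (\<lambda>\<omega>. (\<Sum>k<n. (f (X (z k) \<omega>) - expectation (\<lambda>\<omega>. f (X (z k) \<omega>))))\<^sup>2)
    \<le> C\<^sup>2 * infsum (\<lambda>l. expectation (\<lambda>\<omega>. X l \<omega> * X 0 \<omega>)) UNIV * real (self_intersections z n)"
proof -
  define r where "r l = expectation (\<lambda>\<omega>. X l \<omega> * X 0 \<omega>)" for l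
  define Y where "Y l \<omega> = f (X l \<omega>) - expectation (\<lambda>\<omega>. f (X l \<omega>))" for l \<omega>
  have [measurable]: "random_variable borel (Y l)" for l
    unfolding Y_def by measurable
  have X: "integrable M (X l)" for l
    by (rule square_integrable_imp_integrable[OF _ sq]) simp
  have XX: "integrable M (\<lambda>\<omega>. X l \<omega> * X m \<omega>)" for l m
    by (intro integrable_mult_square_integrable sq) auto
  have cov: "covariance M (X l) (X m) = r (l - m) - \<mu>\<^sup>2" for l m
    using stationary_expectation_mult[OF stat, of l m]
    by (simp add: covariance_eq X XX same r_def power2_eq_square)
  \<comment> \<open>Association makes \<open>r l - \<mu>\<^sup>2\<close> nonnegative, which yields
    the sign of \<open>r\<close> that the summation estimate requires.\<close>
  have "0 \<le> covariance M (X l) (X 0)" for l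
    using associated_field_covariance_nonneg[OF assoc, of "\<lambda>x. x" "\<lambda>x. x" l 0] X XX by (simp add: mono_def)
  hence r: "0 \<le> r l" for l
    using cov[of l 0] zero_le_power2[of \<mu>] by (metis diff_0_right diff_ge_0_iff_ge order_trans)
  have Yb: "\<bar>Y l \<omega>\<bar> \<le> \<bar>B\<bar> + \<bar>expectation (\<lambda>\<omega>. f (X l \<omega>))\<bar>" for l \<omega>
    using bound[of "X l \<omega>"] unfolding Y_def by linarith
  have YY: "integrable M (\<lambda>\<omega>. Y l \<omega> * Y m \<omega>)" for l m
  proof (rule integrable_const_bound)
    show "AE \<omega> in M. norm (Y l \<omega> * Y m \<omega>) \<le> (\<bar>B\<bar> + \<bar>expectation (\<lambda>\<omega>. f (X l \<omega>))\<bar>)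
        * (\<bar>B\<bar> + \<bar>expectation (\<lambda>\<omega>. f (X m \<omega>))\<bar>)"
      by (auto simp: abs_mult intro!: mult_mono Yb)
  qed simp
  have "expectation (\<lambda>\<omega>. (\<Sum>k<n. Y (z k) \<omega>)\<^sup>2) =
      (\<Sum>j<n. \<Sum>k<n. expectation (\<lambda>\<omega>. Y (z j) \<omega> * Y (z k) \<omega>))"
    by (simp add: power2_eq_square sum_product YY)
  also have "\<dots> \<le> (\<Sum>j<n. \<Sum>k<n. C\<^sup>2 * r (z j - z k))"
  proof (intro sum_mono)
    fix j k
    have "expectation (\<lambda>\<omega>. Y (z j) \<omega> * Y (z k) \<omega>) =
        covariance M (\<lambda>\<omega>. f (X (z j) \<omega>)) (\<lambda>\<omega>. f (X (z k) \<omega>))"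
      by (simp add: covariance_def Y_def)
    also have "\<dots> \<le> C\<^sup>2 * covariance M (X (z j)) (X (z k))"
      by (rule associated_covariance_Lipschitz[OF assoc _ sq lip _ bound]) auto
    \<comment> \<open>The covariance equals \<open>r (z j - z k) - \<mu>\<^sup>2\<close>; the
      subtracted square is dropped.\<close>
    also have "\<dots> \<le> C\<^sup>2 * r (z j - z k)"
      by (intro mult_left_mono) (auto simp: cov)
    finally show "expectation (\<lambda>\<omega>. Y (z j) \<omega> * Y (z k) \<omega>) \<le> C\<^sup>2 * r (z j - z k)" .
  qed
  also have "\<dots> = C\<^sup>2 * (\<Sum>j<n. \<Sum>k<n. r (z j - z k))"
    by (simp add: sum_distrib_left)
  also have "\<dots> \<le> C\<^sup>2 * (infsum r UNIV * real (self_intersections z n))"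
    by (intro mult_left_mono sum_differences_le r) (use summ in \<open>auto simp: r_def\<close>)
  finally show ?thesis by (simp add: Y_def r_def[abs_def] mult.assoc)
qed

text \<open>Chebyshev's inequality divides the second moment by
  \<open>(\<epsilon> * n)\<^sup>2\<close>, which cancels the square of \<open>n\<close> in the
  growth bound on the self-intersections and leaves the power of the logarithm.\<close>

lemma tail_bound_associated:
  fixes X :: "'l::ab_group_add \<Rightarrow> 'a \<Rightarrow> real"
  assumes stat: "strictly_stationary M X" and assoc: "associated_field M X"
    and [measurable]: "\<And>l. random_variable borel (X l)"
    and sq: "\<And>l. integrable M (\<lambda>\<omega>. (X l \<omega>)\<^sup>2)"
    and same: "\<And>l. expectation (X l) = \<mu>"
    and summ: "(\<lambda>l. expectation (\<lambda>\<omega>. X l \<omega> * X 0 \<omega>)) summable_on UNIV"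
    and lip: "\<And>x y. \<bar>f x - f y\<bar> \<le> C * \<bar>x - y\<bar>"
    and [measurable]: "f \<in> borel_measurable borel"
    and bound: "\<And>x. \<bar>f x\<bar> \<le> B"
    and V: "(\<lambda>n. real (self_intersections z n)) \<in> O(\<lambda>n. (real n)\<^sup>2 * ln (real n) powr - (1 + \<eta>))"
    and "\<epsilon> > 0"
  shows "(\<lambda>n. prob {\<omega>\<in>space M.
      \<epsilon> * real n \<le> \<bar>\<Sum>k<n. (f (X (z k) \<omega>) - expectation (\<lambda>\<omega>. f (X (z k) \<omega>)))\<bar>})
    \<in> O(\<lambda>n. ln (real n) powr - (1 + \<eta>))"
proof -
  define S where "S n \<omega> = (\<Sum>k<n. (f (X (z k) \<omega>) - expectation (\<lambda>\<omega>. f (X (z k) \<omega>))))" for n \<omega>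
  have [measurable]: "random_variable borel (S n)" for n
    unfolding S_def by measurable
  define K where "K = C\<^sup>2 * infsum (\<lambda>l. expectation (\<lambda>\<omega>. X l \<omega> * X 0 \<omega>)) UNIV / \<epsilon>\<^sup>2"
  have Sb: "\<bar>S n \<omega>\<bar> \<le> (\<Sum>k<n. \<bar>B\<bar> + \<bar>expectation (\<lambda>\<omega>. f (X (z k) \<omega>))\<bar>)" for n \<omega>
    unfolding S_def
  proof (rule order_trans[OF sum_abs sum_mono])
    fix k
    show "\<bar>f (X (z k) \<omega>) - expectation (\<lambda>\<omega>. f (X (z k) \<omega>))\<bar>
        \<le> \<bar>B\<bar> + \<bar>expectation (\<lambda>\<omega>. f (X (z k) \<omega>))\<bar>"
      using bound[of "X (z k) \<omega>"] by linarith
  qed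
  have S2: "integrable M (\<lambda>\<omega>. (S n \<omega>)\<^sup>2)" for n
  proof (rule integrable_const_bound)
    show "AE \<omega> in M. norm ((S n \<omega>)\<^sup>2) \<le> (\<Sum>k<n. \<bar>B\<bar> + \<bar>expectation (\<lambda>\<omega>. f (X (z k) \<omega>))\<bar>)\<^sup>2"
      using power_mono[OF Sb abs_ge_zero, of n _ 2] by simp
  qed simp
  have "(\<lambda>n. prob {\<omega>\<in>space M. \<epsilon> * real n \<le> \<bar>S n \<omega>\<bar>})
      \<in> O(\<lambda>n. K / (real n)\<^sup>2 * real (self_intersections z n))"
  proof (rule bigoI[where c = 1])
    show "eventually (\<lambda>n. norm (prob {\<omega>\<in>space M. \<epsilon> * real n \<le> \<bar>S n \<omega>\<bar>})
        \<le> 1 * norm (K / (real n)\<^sup>2 * real (self_intersections z n))) sequentially"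
      using eventually_gt_at_top[of 0]
    proof eventually_elim
      case (elim n)
      have "prob {\<omega>\<in>space M. \<epsilon> * real n \<le> \<bar>S n \<omega>\<bar>} \<le> expectation (\<lambda>\<omega>. (S n \<omega>)\<^sup>2) / (\<epsilon> * real n)\<^sup>2"
        by (rule second_moment_method[OF _ S2]) (use elim \<open>\<epsilon> > 0\<close> in auto)
      also have "\<dots> \<le> C\<^sup>2 * infsum (\<lambda>l. expectation (\<lambda>\<omega>. X l \<omega> * X 0 \<omega>)) UNIV
          * real (self_intersections z n) / (\<epsilon> * real n)\<^sup>2"
        unfolding S_def
        by (intro divide_right_mono second_moment_along[OF stat assoc _ sq same summ lip _ bound]) auto
      also have "\<dots> = K / (real n)\<^sup>2 * real (self_intersections z n)"
        by (simp add: K_def power_mult_distrib)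
      finally show ?case using abs_ge_self[of "K / (real n)\<^sup>2 * real (self_intersections z n)"]
        by (simp only: real_norm_def abs_of_nonneg measure_nonneg mult_1)
    qed
  qed
  also have "(\<lambda>n. K / (real n)\<^sup>2 * real (self_intersections z n))
      \<in> O(\<lambda>n. 1 / (real n)\<^sup>2 * ((real n)\<^sup>2 * ln (real n) powr - (1 + \<eta>)))"
    by (rule landau_o.big.mult[OF _ V]) (rule bigoI[where c = "\<bar>K\<bar>"], simp)
  also have "(\<lambda>n. 1 / (real n)\<^sup>2 * ((real n)\<^sup>2 * ln (real n) powr - (1 + \<eta>)))
      \<in> O(\<lambda>n. ln (real n) powr - (1 + \<eta>))"
    \<comment> \<open>The bound also holds at \<open>n = 0\<close>, where division by zero makes the
      left side 0.\<close>
    by (rule bigoI[where c = 1]) (auto intro!: always_eventually)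
  finally show ?thesis by (simp add: S_def)
qed

end

section \<open>Empirical distribution functions\<close>

text \<open>Times run from 0 to \<open>n - 1\<close>; the variant over \<open>1..n\<close> is
  reached through \<open>uniform_limit_empirical_cdf_shift\<close>. At \<open>n = 0\<close> the
  value is 0.\<close>

definition empirical_cdf :: "(nat \<Rightarrow> real) \<Rightarrow> nat \<Rightarrow> real \<Rightarrow> real" where
  "empirical_cdf x n s = 1 / real n * (\<Sum>k<n. indicator {..s} (x k))"

lemma average_in_unit_interval:
  fixes y :: "nat \<Rightarrow> real"
  assumes "\<And>k. 0 \<le> y k" "\<And>k. y k \<le> 1"
  shows "0 \<le> 1 / real n * (\<Sum>k<n. y k)" "1 / real n * (\<Sum>k<n. y k) \<le> 1"
proof -
  show "0 \<le> 1 / real n * (\<Sum>k<n. y k)" by (simp add: sum_nonneg assms)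
  have "(\<Sum>k<n. y k) \<le> real n" using sum_mono[of "{..<n}" y "\<lambda>_. 1"] assms by simp
  thus "1 / real n * (\<Sum>k<n. y k) \<le> 1" by (cases "n = 0") (simp_all add: divide_simps)
qed

lemma average_mono:
  fixes x y :: "nat \<Rightarrow> real"
  assumes "\<And>k. x k \<le> y k"
  shows "1 / real n * (\<Sum>k<n. x k) \<le> 1 / real n * (\<Sum>k<n. y k)"
  by (intro mult_left_mono sum_mono assms) simp

lemma empirical_cdf_mono: "mono (empirical_cdf x n)"
  unfolding empirical_cdf_def by (intro monoI average_mono) (auto simp: indicator_def)

lemma uniform_limit_imp_SUP_tendsto_0:
  fixes H :: "nat \<Rightarrow> 'b \<Rightarrow> real"
  assumes "uniform_limit UNIV H F sequentially"
  shows "(\<lambda>n. SUP s. \<bar>H n s - F s\<bar>) \<longlonglongrightarrow> 0"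
proof (rule tendstoI)
  fix e :: real assume "e > 0"
  \<comment> \<open>Strict bounds become weak ones under the supremum, hence
    \<open>e / 2\<close>.\<close>
  hence "eventually (\<lambda>n. \<forall>s\<in>UNIV. dist (H n s) (F s) < e / 2) sequentially"
    using assms by (intro uniform_limitD) auto
  thus "eventually (\<lambda>n. dist (SUP s. \<bar>H n s - F s\<bar>) 0 < e) sequentially"
  proof eventually_elim
    case (elim n)
    hence le: "\<bar>H n s - F s\<bar> \<le> e / 2" for s by (simp add: dist_real_def less_imp_le)
    have "(SUP s. \<bar>H n s - F s\<bar>) \<le> e / 2" by (rule cSUP_least) (use le in auto)
    \<comment> \<open>Any point would do: it shows that the supremum is nonnegative.\<close>
    moreover have "0 \<le> \<bar>H n undefined - F undefined\<bar>" by simp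
    moreover have "\<bar>H n undefined - F undefined\<bar> \<le> (SUP s. \<bar>H n s - F s\<bar>)"
      by (rule cSUP_upper) (use le in \<open>auto intro!: bdd_aboveI2[where M = "e / 2"]\<close>)
    ultimately show ?case using \<open>e > 0\<close> by (simp add: dist_real_def)
  qed
qed

text \<open>The two sums differ only in the terms with indices 0 and \<open>n\<close>, which changes
  the average by at most \<open>1 / n\<close>, uniformly in \<open>s\<close>.\<close>

lemma uniform_limit_empirical_cdf_shift:
  assumes "uniform_limit UNIV (empirical_cdf x) F sequentially"
  shows "uniform_limit UNIV (\<lambda>n s. 1 / real n * (\<Sum>k=1..n. indicator {..s} (x k))) F sequentially"
proof -
  define d where "d n s = 1 / real n * (indicator {..s} (x n) - indicator {..s} (x 0))" for n s
  have "uniform_limit UNIV d (\<lambda>_. 0) sequentially"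
  proof (rule uniform_limitI)
    fix e :: real assume "e > 0"
    then obtain n0 where "inverse (real (Suc n0)) < e" using reals_Archimedean by blast
    show "eventually (\<lambda>n. \<forall>s\<in>UNIV. dist (d n s) 0 < e) sequentially"
      using eventually_ge_at_top[of "Suc n0"]
    proof eventually_elim
      case (elim n)
      have "\<bar>d n s\<bar> \<le> 1 / real n" for s
        by (auto simp: d_def indicator_def)
      also have "1 / real n \<le> inverse (real (Suc n0))"
        using elim by (simp add: field_simps)
      finally show ?case using \<open>inverse (real (Suc n0)) < e\<close>
        by (auto intro: order_le_less_trans)
    qed
  qed
  from uniform_limit_add[OF assms this]
  have "uniform_limit UNIV (\<lambda>n s. empirical_cdf x n s + d n s) F sequentially" by simp
  moreover have "empirical_cdf x n s + d n s = 1 / real n * (\<Sum>k=1..n. indicator {..s} (x k))" for n s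
  proof -
    have "(\<Sum>k<n. indicator {..s} (x k)) + indicator {..s} (x n) =
        indicator {..s} (x 0) + (\<Sum>k=1..n. indicator {..s} (x k) :: real)"
      by (induction n) auto
    hence "(\<Sum>k=1..n. indicator {..s} (x k)) = (\<Sum>k<n. indicator {..s} (x k))
        + (indicator {..s} (x n) - indicator {..s} (x 0) :: real)"
      by linarith
    thus ?thesis by (simp only: empirical_cdf_def d_def distrib_left)
  qed
  ultimately show ?thesis by simp
qed

text \<open>For \<open>a < b\<close> this is 1 up to \<open>a\<close>, 0 from \<open>b\<close> on,
  and linear in between. It stands in for a half-line indicator, which is not Lipschitz as the
  covariance bound demands.\<close>

definition ramp :: "real \<Rightarrow> real \<Rightarrow> real \<Rightarrow> real" where
  "ramp a b x = max 0 (min 1 ((b - x) / (b - a)))"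

lemma ramp_bounds: "0 \<le> ramp a b x" "ramp a b x \<le> 1"
  by (auto simp: ramp_def)

lemma ramp_indicator:
  assumes "a < b"
  shows "indicator {..a} x \<le> ramp a b x" "ramp a b x \<le> indicator {..b} x"
  using assms by (auto simp: ramp_def indicator_def divide_simps)

text \<open>Clamping to the unit interval does not increase distances, so the slope of the linear
  part is a Lipschitz constant.\<close>

lemma ramp_Lipschitz:
  assumes "a < b"
  shows "\<bar>ramp a b x - ramp a b y\<bar> \<le> 1 / (b - a) * \<bar>x - y\<bar>"
proof -
  have "\<bar>ramp a b x - ramp a b y\<bar> \<le> \<bar>(b - x) / (b - a) - (b - y) / (b - a)\<bar>"
    unfolding ramp_def by linarith
  also have "(b - x) / (b - a) - (b - y) / (b - a) = 1 / (b - a) * (y - x)"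
    by (simp add: diff_divide_distrib[symmetric])
  finally show ?thesis using assms by (simp add: abs_mult abs_minus_commute)
qed

lemma borel_measurable_ramp [measurable]: "ramp a b \<in> borel_measurable borel"
  unfolding ramp_def by measurable

lemma (in real_distribution) integral_ramp_bounds:
  assumes "a < b"
  shows "cdf M a \<le> (\<integral>x. ramp a b x \<partial>M)" "(\<integral>x. ramp a b x \<partial>M) \<le> cdf M b"
proof -
  have ramp: "integrable M (ramp a b)"
    by (rule integrable_const_bound[where B = 1]) (auto simp: ramp_bounds)
  have ind: "integrable M (indicator {..c} :: real \<Rightarrow> real)"
    "(\<integral>x. indicator {..c} x \<partial>M) = cdf M c" for c
    by (auto simp: cdf_def less_top[symmetric])
  show "cdf M a \<le> (\<integral>x. ramp a b x \<partial>M)" "(\<integral>x. ramp a b x \<partial>M) \<le> cdf M b"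
    unfolding ind(2)[symmetric] by (intro integral_mono ind ramp ramp_indicator assms)+
qed

text \<open>Ramps that end before \<open>s\<close> bound the empirical value from below, ramps that
  start after \<open>s\<close> bound it from above. By continuity at \<open>s\<close> their
  integrals come arbitrarily close to \<open>cdf M s\<close>.\<close>

lemma (in real_distribution) empirical_cdf_tendsto_at_continuity:
  assumes ramps: "\<And>a b. \<lbrakk>a \<in> \<rat>; b \<in> \<rat>; a < b\<rbrakk> \<Longrightarrow>
      (\<lambda>n. 1 / real n * (\<Sum>k<n. ramp a b (x k))) \<longlonglongrightarrow> (\<integral>t. ramp a b t \<partial>M)"
    and "isCont (cdf M) s"
  shows "(\<lambda>n. empirical_cdf x n s) \<longlonglongrightarrow> cdf M s"
proof (rule order_tendstoI)
  have lim: "(cdf M \<longlongrightarrow> cdf M s) (at s)" using assms(2) by (simp add: isCont_def)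
  {
    fix y assume "y < cdf M s"
    from order_tendstoD(1)[OF lim this] obtain d where
      d: "d > 0" "\<And>t. t \<noteq> s \<Longrightarrow> dist t s < d \<Longrightarrow> y < cdf M t"
      by (auto simp: eventually_at)
    \<comment> \<open>Both end points lie in \<open>(s - d, s)\<close>, so the integral is at least
      \<open>cdf M a > y\<close>.\<close>
    obtain b where b: "b \<in> \<rat>" "s - d < b" "b < s" using Rats_dense_in_real[of "s - d" s] d by auto
    obtain a where a: "a \<in> \<rat>" "s - d < a" "a < b" using Rats_dense_in_real[of "s - d" b] b by auto
    have "y < (\<integral>t. ramp a b t \<partial>M)"
      using d(2)[of a] a b integral_ramp_bounds(1)[OF a(3)] by (auto simp: dist_real_def)
    from order_tendstoD(1)[OF ramps[OF a(1) b(1) a(3)] this]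
    show "eventually (\<lambda>n. y < empirical_cdf x n s) sequentially"
    proof eventually_elim
      case (elim n)
      also have "1 / real n * (\<Sum>k<n. ramp a b (x k)) \<le> empirical_cdf x n b"
        unfolding empirical_cdf_def by (intro average_mono ramp_indicator a)
      also have "\<dots> \<le> empirical_cdf x n s"
        using empirical_cdf_mono[of x n] b by (simp add: mono_def)
      finally show ?case .
    qed
  next
    fix y assume "cdf M s < y"
    from order_tendstoD(2)[OF lim this] obtain d where
      d: "d > 0" "\<And>t. t \<noteq> s \<Longrightarrow> dist t s < d \<Longrightarrow> cdf M t < y"
      by (auto simp: eventually_at)
    \<comment> \<open>Mirror image: both end points lie in \<open>(s, s + d)\<close>, so the
      integral is at most \<open>cdf M b < y\<close>.\<close>
    obtain a where a: "a \<in> \<rat>" "s < a" "a < s + d" using Rats_dense_in_real[of s "s + d"] d by auto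
    obtain b where b: "b \<in> \<rat>" "a < b" "b < s + d" using Rats_dense_in_real[of a "s + d"] a by auto
    have "(\<integral>t. ramp a b t \<partial>M) < y"
      using d(2)[of b] a b integral_ramp_bounds(2)[OF b(2)] by (auto simp: dist_real_def)
    from order_tendstoD(2)[OF ramps[OF a(1) b(1) b(2)] this]
    show "eventually (\<lambda>n. empirical_cdf x n s < y) sequentially"
    proof eventually_elim
      case (elim n)
      have "empirical_cdf x n s \<le> empirical_cdf x n a"
        using empirical_cdf_mono[of x n] a by (simp add: mono_def)
      also have "\<dots> \<le> 1 / real n * (\<Sum>k<n. ramp a b (x k))"
        unfolding empirical_cdf_def by (intro average_mono ramp_indicator b)
      finally show ?case using elim by linarith
    qed
  }
qed

text \<open>By continuity every open half-line has the mass of the closed one, so the empirical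
  function can itself play the role of \<open>L\<close> in the quantile criterion.\<close>

lemma (in cdf_distribution) Polya_uniform_limit:
  assumes cont: "continuous_on UNIV (cdf M)"
    and lim: "\<And>s. (\<lambda>n. empirical_cdf x n s) \<longlonglongrightarrow> cdf M s"
  shows "uniform_limit UNIV (empirical_cdf x) (cdf M) sequentially"
proof -
  have left: "measure M {..<q} = cdf M q" for q
  proof (rule tendsto_unique[OF _ cdf_at_left])
    show "(cdf M \<longlongrightarrow> cdf M q) (at_left q)"
      using cont by (auto simp: continuous_on_def intro: tendsto_within_subset)
  qed simp
  show ?thesis
  proof (rule uniform_limit_cdf_if_tendsto_at_quantiles[where L = "empirical_cdf x"])
    show "empirical_cdf x n s \<le> empirical_cdf x n q" if "s < q" for n s q
      using empirical_cdf_mono[of x n] that by (simp add: mono_def)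
    show "0 \<le> empirical_cdf x n s" "empirical_cdf x n s \<le> 1" for n s
      unfolding empirical_cdf_def by (intro average_in_unit_interval; simp add: indicator_def)+
  qed (simp_all add: empirical_cdf_mono left lim)
qed

text \<open>The common law makes all centering terms the same constant \<open>c\<close>. It lies in
  the unit interval, so the centered terms are bounded by 1.\<close>

lemma (in prob_space) AE_average_tendsto_integral:
  fixes X :: "'l \<Rightarrow> 'a \<Rightarrow> real" and f :: "real \<Rightarrow> real"
  assumes [measurable]: "\<And>l. random_variable borel (X l)"
    and distr: "\<And>l. distr M borel (X l) = D"
    and [measurable]: "f \<in> borel_measurable borel"
    and f01: "\<And>x. 0 \<le> f x" "\<And>x. f x \<le> 1"
    and "\<delta> > 0"
    and tail: "\<And>\<epsilon>. \<epsilon> > 0 \<Longrightarrow> (\<lambda>n. prob {\<omega>\<in>space M.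
      \<epsilon> * real n \<le> \<bar>\<Sum>k<n. (f (X (z k) \<omega>) - expectation (\<lambda>\<omega>. f (X (z k) \<omega>)))\<bar>})
    \<in> O(\<lambda>n. ln (real n) powr - (1 + \<delta>))"
  shows "AE \<omega> in M. (\<lambda>n. 1 / real n * (\<Sum>k<n. f (X (z k) \<omega>))) \<longlonglongrightarrow> (\<integral>x. f x \<partial>D)"
proof -
  define c where "c = (\<integral>x. f x \<partial>D)"
  have c: "expectation (\<lambda>\<omega>. f (X l \<omega>)) = c" for l
    unfolding c_def distr[of l, symmetric] by (rule integral_distr[symmetric]) auto
  have int: "integrable M (\<lambda>\<omega>. f (X l \<omega>))" for l
    by (rule integrable_const_bound[where B = 1]) (use f01 in auto)
  have "0 \<le> c" unfolding c_def by (simp add: f01)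
  have "c \<le> 1" unfolding c[of undefined, symmetric]
    using integral_mono[OF int, of "\<lambda>_. 1" undefined] f01 by (simp add: prob_space)
  have "AE \<omega> in M. (\<lambda>n. 1 / real n * (\<Sum>k<n. (f (X (z k) \<omega>) - c))) \<longlonglongrightarrow> 0"
  proof (rule AE_averages_tendsto_0[OF _ _ \<open>\<delta> > 0\<close>])
    show "\<bar>f (X (z k) \<omega>) - c\<bar> \<le> 1" for k \<omega>
      using f01[of "X (z k) \<omega>"] \<open>0 \<le> c\<close> \<open>c \<le> 1\<close> by linarith
  qed (use tail c in auto)
  thus ?thesis
  proof (rule AE_mp, intro AE_I2 impI)
    fix \<omega> assume "(\<lambda>n. 1 / real n * (\<Sum>k<n. (f (X (z k) \<omega>) - c))) \<longlonglongrightarrow> 0"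
    hence "(\<lambda>n. 1 / real n * (\<Sum>k<n. (f (X (z k) \<omega>) - c)) + c) \<longlonglongrightarrow> 0 + c"
      by (intro tendsto_add tendsto_const)
    \<comment> \<open>This fails at \<open>n = 0\<close> unless \<open>c = 0\<close>, since both
      averages are then 0.\<close>
    moreover have "eventually (\<lambda>n. 1 / real n * (\<Sum>k<n. (f (X (z k) \<omega>) - c)) + c
        = 1 / real n * (\<Sum>k<n. f (X (z k) \<omega>))) sequentially"
      using eventually_gt_at_top[of 0]
      by eventually_elim (simp add: sum_subtractf diff_divide_distrib)
    ultimately show "(\<lambda>n. 1 / real n * (\<Sum>k<n. f (X (z k) \<omega>))) \<longlonglongrightarrow> (\<integral>x. f x \<partial>D)"
      by (simp add: c_def filterlim_cong)
  qed
qed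

text \<open>The exponential bound accepts any measurable function with values in the unit interval,
  so indicators of closed and of open half-lines can be used directly; the open ones supply the left
  limits.\<close>

lemma (in prob_space) Glivenko_Cantelli_along_indep:
  fixes X :: "'l \<Rightarrow> 'a \<Rightarrow> real"
  assumes X [measurable]: "\<And>l. random_variable borel (X l)"
    and distr: "\<And>l. distr M borel (X l) = D"
    and indep: "indep_vars (\<lambda>_. borel) X UNIV"
    and V: "(\<lambda>n. real (self_intersections z n)) \<in> o(\<lambda>n. (real n)\<^sup>2 * inverse (ln (ln (real n))))"
  shows "AE \<omega> in M. uniform_limit UNIV (empirical_cdf (\<lambda>k. X (z k) \<omega>)) (cdf D) sequentially"
proof -
  interpret D: cdf_distribution D
    unfolding cdf_distribution_def distr[of undefined, symmetric] by simp
  have lim: "AE \<omega> in M. (\<lambda>n. 1 / real n * (\<Sum>k<n. indicator A (X (z k) \<omega>))) \<longlonglongrightarrow> measure D A"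
    if [measurable]: "A \<in> sets borel" for A
  proof -
    have "AE \<omega> in M. (\<lambda>n. 1 / real n * (\<Sum>k<n. indicator A (X (z k) \<omega>))) \<longlonglongrightarrow> (\<integral>x. indicator A x \<partial>D)"
      by (rule AE_average_tendsto_integral[OF X distr _ _ _ zero_less_one tail_bound_indep[OF indep]])
        (use V in auto)
    thus ?thesis by simp
  qed
  \<comment> \<open>Countability of the quantiles gives one null set for all of them.\<close>
  have "AE \<omega> in M. \<forall>q\<in>D.quantiles.
      (\<lambda>n. 1 / real n * (\<Sum>k<n. indicator {..q} (X (z k) \<omega>))) \<longlonglongrightarrow> measure D {..q} \<and>
      (\<lambda>n. 1 / real n * (\<Sum>k<n. indicator {..<q} (X (z k) \<omega>))) \<longlonglongrightarrow> measure D {..<q}"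
    unfolding AE_ball_countable[OF D.countable_quantiles] using lim by auto
  thus ?thesis
  proof (rule AE_mp, intro AE_I2 impI)
    fix \<omega> assume *: "\<forall>q\<in>D.quantiles.
      (\<lambda>n. 1 / real n * (\<Sum>k<n. indicator {..q} (X (z k) \<omega>))) \<longlonglongrightarrow> measure D {..q} \<and>
      (\<lambda>n. 1 / real n * (\<Sum>k<n. indicator {..<q} (X (z k) \<omega>))) \<longlonglongrightarrow> measure D {..<q}"
    show "uniform_limit UNIV (empirical_cdf (\<lambda>k. X (z k) \<omega>)) (cdf D) sequentially"
    proof (rule D.uniform_limit_cdf_if_tendsto_at_quantiles[where L = "\<lambda>n q. 1 / real n * (\<Sum>k<n. indicator {..<q} (X (z k) \<omega>))"])
      show "0 \<le> empirical_cdf (\<lambda>k. X (z k) \<omega>) n s" "empirical_cdf (\<lambda>k. X (z k) \<omega>) n s \<le> 1" for n s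
        unfolding empirical_cdf_def by (intro average_in_unit_interval; simp add: indicator_def)+
      show "empirical_cdf (\<lambda>k. X (z k) \<omega>) n s
          \<le> 1 / real n * (\<Sum>k<n. indicator {..<q} (X (z k) \<omega>))" if "s < q" for n s q
        unfolding empirical_cdf_def by (rule average_mono) (use that in \<open>auto simp: indicator_def\<close>)
    qed (use * in \<open>simp_all add: empirical_cdf_mono empirical_cdf_def cdf_def2\<close>)
  qed
qed

text \<open>The ramps with rational end points form a countable family, so their averages converge
  simultaneously off one null set. Continuity points are then handled for each fixed
  outcome.\<close>

lemma (in prob_space) empirical_cdf_along_associated:
  fixes X :: "'l::ab_group_add \<Rightarrow> 'a \<Rightarrow> real"
  assumes X [measurable]: "\<And>l. random_variable borel (X l)"
    and distr: "\<And>l. distr M borel (X l) = D"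
    and stat: "strictly_stationary M X" and assoc: "associated_field M X"
    and sq: "\<And>l. integrable M (\<lambda>\<omega>. (X l \<omega>)\<^sup>2)"
    and summ: "(\<lambda>l. expectation (\<lambda>\<omega>. X l \<omega> * X 0 \<omega>)) summable_on UNIV"
    and "\<eta> > 0"
    and V: "(\<lambda>n. real (self_intersections z n)) \<in> O(\<lambda>n. (real n)\<^sup>2 * ln (real n) powr - (1 + \<eta>))"
  shows "AE \<omega> in M. \<forall>s. isCont (cdf D) s \<longrightarrow>
    (\<lambda>n. empirical_cdf (\<lambda>k. X (z k) \<omega>) n s) \<longlonglongrightarrow> cdf D s"
proof -
  interpret D: real_distribution D
    unfolding distr[of undefined, symmetric] by simp
  have same: "expectation (X l) = (\<integral>x. x \<partial>D)" for l
    unfolding distr[of l, symmetric] by (rule integral_distr[symmetric]) auto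
  have "countable {(a, b). a \<in> \<rat> \<and> b \<in> \<rat> \<and> a < (b :: real)}"
    by (rule countable_subset[of _ "\<rat> \<times> \<rat>"]) (auto simp: countable_rat)
  moreover have "AE \<omega> in M. (\<lambda>n. 1 / real n * (\<Sum>k<n. ramp a b (X (z k) \<omega>))) \<longlonglongrightarrow> (\<integral>x. ramp a b x \<partial>D)"
    if "a < b" for a b
  proof (rule AE_average_tendsto_integral[OF X distr _ _ _ \<open>\<eta> > 0\<close>])
    fix \<epsilon> :: real assume "\<epsilon> > 0"
    show "(\<lambda>n. prob {\<omega>\<in>space M. \<epsilon> * real n \<le>
        \<bar>\<Sum>k<n. (ramp a b (X (z k) \<omega>) - expectation (\<lambda>\<omega>. ramp a b (X (z k) \<omega>)))\<bar>})
      \<in> O(\<lambda>n. ln (real n) powr - (1 + \<eta>))"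
    proof (rule tail_bound_associated[OF stat assoc X sq same summ ramp_Lipschitz[OF that] _ _ V \<open>\<epsilon> > 0\<close>])
      show "\<bar>ramp a b x\<bar> \<le> 1" for x using ramp_bounds[of a b x] by simp
    qed simp
  qed (auto simp: ramp_bounds)
  ultimately have "AE \<omega> in M. \<forall>(a, b)\<in>{(a, b). a \<in> \<rat> \<and> b \<in> \<rat> \<and> a < b}.
      (\<lambda>n. 1 / real n * (\<Sum>k<n. ramp a b (X (z k) \<omega>))) \<longlonglongrightarrow> (\<integral>x. ramp a b x \<partial>D)"
    by (subst AE_ball_countable) auto
  thus ?thesis
    by (rule AE_mp) (intro AE_I2 impI allI D.empirical_cdf_tendsto_at_continuity; blast)
qed

theorem theorem1p6:
  fixes M :: "'a measure"
    and X :: "int ^ 'd \<Rightarrow> 'a \<Rightarrow> real"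
    and F :: "real \<Rightarrow> real"
    and z :: "nat \<Rightarrow> int ^ 'd"
  assumes "prob_space M"
    and "\<And>l. X l \<in> borel_measurable M"
    and "\<And>l. cdf (distr M borel (X l)) = F"
  shows
    "(prob_space.indep_vars M (\<lambda>_. borel) X UNIV \<longrightarrow>
      (\<lambda>n. real (self_intersections z n)) \<in> o(\<lambda>n. (real n)\<^sup>2 * inverse (ln (ln (real n)))) \<longrightarrow>
      (AE \<omega> in M.
        (\<lambda>n. SUP s. \<bar>1 / real n * (\<Sum>k=1..n. indicator {..s} (X (z k) \<omega>)) - F s\<bar>)
          \<longlonglongrightarrow> 0))
     \<and>
     (strictly_stationary M X \<longrightarrow> associated_field M X \<longrightarrow>
      (\<forall>l. integrable M (\<lambda>\<omega>. (X l \<omega>)\<^sup>2)) \<longrightarrow>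
      (\<lambda>l. \<integral>\<omega>. X l \<omega> * X 0 \<omega> \<partial>M) summable_on UNIV \<longrightarrow>
      (\<exists>\<eta>>0. (\<lambda>n. real (self_intersections z n)) \<in>
         O(\<lambda>n. (real n)\<^sup>2 * ln (real n) powr (- (1 + \<eta>)))) \<longrightarrow>
      (AE \<omega> in M. \<forall>s. isCont F s \<longrightarrow>
        (\<lambda>n. 1 / real n * (\<Sum>k<n. indicator {..s} (X (z k) \<omega>))) \<longlonglongrightarrow> F s)
      \<and>
      (continuous_on UNIV F \<longrightarrow>
        (AE \<omega> in M. uniform_limit UNIV
          (\<lambda>n s. 1 / real n * (\<Sum>k<n. indicator {..s} (X (z k) \<omega>))) F sequentially)))"
proof -
  interpret prob_space M by fact
  note [measurable] = assms(2)
  define D where "D = distr M borel (X 0)"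
  \<comment> \<open>A distribution function determines the law.\<close>
  have distr: "distr M borel (X l) = D" for l
    unfolding D_def by (rule cdf_unique) (use assms in auto)
  have F: "cdf D = F" using assms(3) by (simp add: D_def)
  interpret D: cdf_distribution D
    unfolding cdf_distribution_def D_def by simp
  show ?thesis
  proof (intro conjI impI)
    assume "indep_vars (\<lambda>_. borel) X UNIV"
      "(\<lambda>n. real (self_intersections z n)) \<in> o(\<lambda>n. (real n)\<^sup>2 * inverse (ln (ln (real n))))"
    from Glivenko_Cantelli_along_indep[OF assms(2) distr this]
    show "AE \<omega> in M.
        (\<lambda>n. SUP s. \<bar>1 / real n * (\<Sum>k=1..n. indicator {..s} (X (z k) \<omega>)) - F s\<bar>) \<longlonglongrightarrow> 0"
      unfolding F
      by (rule AE_mp) (intro AE_I2 impI uniform_limit_imp_SUP_tendsto_0 uniform_limit_empirical_cdf_shift)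
  next
    assume b: "strictly_stationary M X" "associated_field M X"
      "\<forall>l. integrable M (\<lambda>\<omega>. (X l \<omega>)\<^sup>2)"
      "(\<lambda>l. \<integral>\<omega>. X l \<omega> * X 0 \<omega> \<partial>M) summable_on UNIV"
      "\<exists>\<eta>>0. (\<lambda>n. real (self_intersections z n)) \<in>
         O(\<lambda>n. (real n)\<^sup>2 * ln (real n) powr (- (1 + \<eta>)))"
    then obtain \<eta> where \<eta>: "\<eta> > 0" "(\<lambda>n. real (self_intersections z n)) \<in>
         O(\<lambda>n. (real n)\<^sup>2 * ln (real n) powr (- (1 + \<eta>)))" by blast
    have lim: "AE \<omega> in M. \<forall>s. isCont F s \<longrightarrow>
        (\<lambda>n. empirical_cdf (\<lambda>k. X (z k) \<omega>) n s) \<longlonglongrightarrow> F s"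
      unfolding F[symmetric]
      by (rule empirical_cdf_along_associated[OF assms(2) distr b(1,2) b(3)[rule_format] b(4) \<eta>])
    thus "AE \<omega> in M. \<forall>s. isCont F s \<longrightarrow>
        (\<lambda>n. 1 / real n * (\<Sum>k<n. indicator {..s} (X (z k) \<omega>))) \<longlonglongrightarrow> F s"
      by (simp add: empirical_cdf_def)
    assume cont: "continuous_on UNIV F"
    \<comment> \<open>Every point is now a continuity point, so pointwise convergence holds
      everywhere for almost every outcome and Polya's argument makes it uniform.\<close>
    hence "isCont F s" for s by (simp add: continuous_on_eq_continuous_at)
    with lim have "AE \<omega> in M. uniform_limit UNIV (empirical_cdf (\<lambda>k. X (z k) \<omega>)) F sequentially"
      using D.Polya_uniform_limit cont by (auto simp: F)
    thus "AE \<omega> in M. uniform_limit UNIV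
          (\<lambda>n s. 1 / real n * (\<Sum>k<n. indicator {..s} (X (z k) \<omega>))) F sequentially"
      by (simp add: empirical_cdf_def[abs_def])
  qed
qed

end
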